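(* Let $A\in\mathbb{R}^{d\times d}$, $B\in\mathbb{R}^{d\times n}$, $M=\begin{bmatrix}Q&S^*\\S&R\end{bmatrix}$ symmetric with $Q\in\mathbb{R}^{d\times d}$, $S\in\mathbb{R}^{n\times d}$, $R\in\mathbb{R}^{n\times n}$, and let $\rho>0$, $\delta\ge0$. For $\lambda\ge0$ set \[ M(\delta,\lambda)=\begin{bmatrix} Q & S^* & 0\\ S & R+\lambda\delta^2 I & 0\\ 0&0&-\lambda I\end{bmatrix},\qquad B_2=\begin{bmatrix} B & B\end{bmatrix}\in\mathbb{R}^{d\times 2n}. \] If there exists $N\in\mathbb{R}^{n\times d}$ such that $A+BN$ is $\rho$-Schur and $Q+2\,\Re\,S^*N+N^*RN\ge0$, then $(A,B_2,M(\delta,\lambda))$ is $\rho$-minimally stable for every $\lambda\ge0$.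
   Context: For a triple $(\mathcal{A},\mathcal{B},\mathcal{M})$ with $\mathcal{A}\in\mathbb{R}^{d\times d}$, $\mathcal{B}\in\mathbb{R}^{d\times q}$ and symmetric $\mathcal{M}=\begin{bmatrix}Q'&S'^*\\S'&R'\end{bmatrix}\in\mathbb{R}^{(d+q)\times(d+q)}$: sequences $(x,w)$ with $x(k)\in\mathbb{R}^d$, $w(k)\in\mathbb{R}^q$ lie in $\mathcal{B}(\mathcal{A},\mathcal{B})$ if $x(k+1)=\mathcal{A}x(k)+\mathcal{B}w(k)$, and in $\mathrm{IQC}(\mathcal{M},\rho)$ if $\sum_{k=0}^N\rho^{-2k}(\langle Q'x(k),x(k)\rangle+2\langle S'x(k),w(k)\rangle+\langle R'w(k),w(k)\rangle)\ge0$ for all $N\ge0$. The triple is $\rho$-minimally stable if for every $x_0\in\mathbb{R}^d$ there is $(x,w)\in\mathcal{B}(\mathcal{A},\mathcal{B})\cap\mathrm{IQC}(\mathcal{M},\rho)$ with $x(0)=x_0$ and $\rho^{-k}x(k)\to0$. For $(A,B_2,M(\delta,\lambda))$ the input is $w=(u,e)\in\mathbb{R}^{2n}$. A square matrix is $\rho$-Schur if its eigenvalues lie in the open disk of radius $\rho$. *)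

theory Defs
  imports "HOL-Analysis.Analysis"
begin

text \<open>Matrices are rendered with type-indexed dimensions: real^'d^'d is d x d,
  real^'q^'d is d x q (d rows, q columns). The symmetric matrix
  M = [Q' S'^*; S' R'] is represented by its blocks Q', S', R'.\<close>

definition behav :: "real^'d^'d \<Rightarrow> real^'q^'d \<Rightarrow> (nat \<Rightarrow> real^'d) \<Rightarrow> (nat \<Rightarrow> real^'q) \<Rightarrow> bool" where
  "behav A B x w \<longleftrightarrow> (\<forall>k. x (Suc k) = A *v x k + B *v w k)"

definition IQC :: "real^'d^'d \<Rightarrow> real^'d^'q \<Rightarrow> real^'q^'q \<Rightarrow> real
    \<Rightarrow> (nat \<Rightarrow> real^'d) \<Rightarrow> (nat \<Rightarrow> real^'q) \<Rightarrow> bool" where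
  "IQC Q' S' R' \<rho> x w \<longleftrightarrow>
     (\<forall>N. 0 \<le> (\<Sum>k\<le>N. inverse (\<rho> ^ (2*k)) *
        ((Q' *v x k) \<bullet> x k + 2 * ((S' *v x k) \<bullet> w k) + (R' *v w k) \<bullet> w k)))"

definition min_stable :: "real \<Rightarrow> real^'d^'d \<Rightarrow> real^'q^'d \<Rightarrow> real^'d^'d \<Rightarrow> real^'d^'q \<Rightarrow> real^'q^'q \<Rightarrow> bool" where
  "min_stable \<rho> A B Q' S' R' \<longleftrightarrow>
     (\<forall>x0. \<exists>x w. behav A B x w \<and> IQC Q' S' R' \<rho> x w \<and> x 0 = x0 \<and>
        ((\<lambda>k. inverse (\<rho> ^ k) *\<^sub>R x k) \<longlonglongrightarrow> 0))"

definition cmat :: "real^'n^'m \<Rightarrow> complex^'n^'m" where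
  "cmat A = (\<chi> i j. complex_of_real (A $ i $ j))"

text \<open>rho-Schur: every (complex) eigenvalue lies in the open disk of radius rho.\<close>
definition rho_schur :: "real \<Rightarrow> real^'d^'d \<Rightarrow> bool" where
  "rho_schur \<rho> A \<longleftrightarrow>
     (\<forall>(c::complex) v. v \<noteq> 0 \<and> cmat A *v v = c *s v \<longrightarrow> cmod c < \<rho>)"

definition psd :: "real^'d^'d \<Rightarrow> bool" where
  "psd P \<longleftrightarrow> (\<forall>x. 0 \<le> x \<bullet> (P *v x))"

text \<open>Input w = (u,e) in R^{2n}, indexed by 'n + 'n (Inl: u, Inr: e).\<close>
definition B2 :: "real^'n^'d \<Rightarrow> real^('n + 'n)^'d" where
  "B2 B = (\<chi> i j. case j of Inl k \<Rightarrow> B $ i $ k | Inr k \<Rightarrow> B $ i $ k)"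

definition S2 :: "real^'d^'n \<Rightarrow> real^'d^('n + 'n)" where
  "S2 S = (\<chi> i j. case i of Inl k \<Rightarrow> S $ k $ j | Inr k \<Rightarrow> 0)"

definition R2 :: "real^'n^'n \<Rightarrow> real \<Rightarrow> real \<Rightarrow> real^('n + 'n)^('n + 'n)" where
  "R2 R \<delta> lam = (\<chi> i j. case (i, j) of
       (Inl a, Inl b) \<Rightarrow> R $ a $ b + lam * \<delta>^2 * (if a = b then 1 else 0)
     | (Inr a, Inr b) \<Rightarrow> - lam * (if a = b then 1 else 0)
     | _ \<Rightarrow> 0)"

end

(* The feedback u = N x with the extra input e switched off turns (A, B2) into the closed loop
   A + B N. Along its trajectories the supply rate of M(delta, lambda) equals
   x' (Q + S'N + N'S + N'RN) x + lambda delta^2 |N x|^2 >= 0, so every partial sum of the IQC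
   is nonnegative. The trajectories decay faster than rho^k because the spectral radius of
   A + B N lies below some r < rho, and the powers of (A + B N) / r stay bounded by the
   Jordan normal form. *)

theory Submission
  imports Defs "Jordan_Normal_Form.Spectral_Radius"
begin

(* Jordan_Normal_Form's vector indexing and scalar product clash with the Cartesian-product
   notation of HOL-Analysis. *)
no_notation vec_index (infixl "$" 100)
no_notation scalar_prod (infix "\<bullet>" 70)
notation vec_index (infixl "$v" 100)

lemma smult_pow_mat:
  fixes a :: "'a :: comm_semiring_1"
  assumes "A \<in> carrier_mat n n"
  shows "(a \<cdot>\<^sub>m A) ^\<^sub>m k = a ^ k \<cdot>\<^sub>m A ^\<^sub>m (k :: nat)"
proof (induction k)
  case 0
  show ?case
    using assms by (intro eq_matI) auto
next
  case (Suc k)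
  have "(a \<cdot>\<^sub>m A) ^\<^sub>m Suc k = (a ^ k \<cdot>\<^sub>m A ^\<^sub>m k) * (a \<cdot>\<^sub>m A)"
    using Suc by simp
  also have "\<dots> = a ^ k \<cdot>\<^sub>m (A ^\<^sub>m k * (a \<cdot>\<^sub>m A))"
    using assms by (intro mult_smult_assoc_mat) auto
  also have "\<dots> = a ^ k \<cdot>\<^sub>m (a \<cdot>\<^sub>m (A ^\<^sub>m k * A))"
    using assms by (subst mult_smult_distrib) auto
  also have "\<dots> = a ^ Suc k \<cdot>\<^sub>m A ^\<^sub>m Suc k"
    using assms by (intro eq_matI) (auto simp: ac_simps)
  finally show ?case .
qed

lemma eigenvalue_smult_mat:
  assumes "A \<in> carrier_mat n n" and "eigenvalue A ev"
  shows "eigenvalue (a \<cdot>\<^sub>m A) (a * ev)"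
proof -
  obtain v where v: "v \<in> carrier_vec n" "v \<noteq> 0\<^sub>v n" "A *\<^sub>v v = ev \<cdot>\<^sub>v v"
    using assms unfolding eigenvalue_def eigenvector_def by auto
  have "(a \<cdot>\<^sub>m A) *\<^sub>v v = a \<cdot>\<^sub>v (A *\<^sub>v v)"
    using assms(1) v(1) by (intro eq_vecI) (auto simp: scalar_prod_def sum_distrib_left ac_simps)
  then have "(a \<cdot>\<^sub>m A) *\<^sub>v v = (a * ev) \<cdot>\<^sub>v v"
    by (simp add: v(3) smult_smult_assoc)
  then show ?thesis
    using assms(1) v unfolding eigenvalue_def eigenvector_def by auto
qed

lemma pow_norm_bound_if_eigenvalues_less:
  fixes A :: "complex mat"
  assumes A: "A \<in> carrier_mat n n" and n: "0 < n"
    and ev_less: "\<And>ev. eigenvalue A ev \<Longrightarrow> cmod ev < \<rho>"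
  shows "\<exists>c r. 0 < r \<and> r < \<rho> \<and> (\<forall>k. norm_bound (A ^\<^sub>m k) (c * r ^ k))"
proof -
  have sr: "0 \<le> spectral_radius A" "spectral_radius A < \<rho>"
    using spectral_radius_mem_max(1)[OF A n] ev_less by (auto simp: spectrum_def)
  define r where "r = (spectral_radius A + \<rho>) / 2"
  have r: "0 < r" "r < \<rho>" "spectral_radius A < r"
    using sr unfolding r_def by auto
  define D where "D = complex_of_real (inverse r) \<cdot>\<^sub>m A"
  have D: "D \<in> carrier_mat n n"
    using A unfolding D_def by simp
  have A_eq: "A = complex_of_real r \<cdot>\<^sub>m D"
    using A r(1) unfolding D_def by (intro eq_matI) auto
  have "spectral_radius D < 1"
  proof -
    obtain ev where ev: "eigenvalue D ev" "spectral_radius D = cmod ev"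
      using spectral_radius_mem_max(1)[OF D n] by (auto simp: spectrum_def)
    have "eigenvalue A (complex_of_real r * ev)"
      using ev(1) unfolding A_eq by (rule eigenvalue_smult_mat[OF D])
    then have "cmod (complex_of_real r * ev) \<le> spectral_radius A"
      by (intro spectral_radius_mem_max(2)[OF A n]) (auto simp: spectrum_def)
    then have "r * cmod ev \<le> spectral_radius A"
      using r(1) by (simp add: norm_mult)
    with r have "r * cmod ev < r * 1"
      by linarith
    with r(1) ev(2) show ?thesis
      by (simp only: mult_less_cancel_left_pos)
  qed
  then obtain c where c: "\<And>k. norm_bound (D ^\<^sub>m k) c"
    using spectral_radius_jnf_norm_bound_less_1_upper_triangular[OF D] by blast
  have "norm_bound (A ^\<^sub>m k) (c * r ^ k)" for k
  proof (rule norm_boundI)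
    fix i j
    assume "i < dim_row (A ^\<^sub>m k)" and "j < dim_col (A ^\<^sub>m k)"
    with A D have ij: "i < dim_row (D ^\<^sub>m k)" "j < dim_col (D ^\<^sub>m k)"
      by auto
    have "norm ((A ^\<^sub>m k) $$ (i, j)) = r ^ k * norm ((D ^\<^sub>m k) $$ (i, j))"
      using ij r(1) by (simp add: A_eq smult_pow_mat[OF D] norm_mult norm_power)
    also have "\<dots> \<le> r ^ k * c"
      using c[of k] ij r(1) unfolding norm_bound_def by (simp add: mult_left_mono)
    finally show "norm ((A ^\<^sub>m k) $$ (i, j)) \<le> c * r ^ k"
      by (simp only: mult.commute)
  qed
  with r show ?thesis by blast
qed

lemma norm_mult_mat_vec_index_le:
  fixes A :: "'a :: {real_normed_field} mat"
  assumes "norm_bound A b" and "A \<in> carrier_mat n m" and "v \<in> carrier_vec m" and "i < n"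
  shows "norm ((A *\<^sub>v v) $v i) \<le> b * (\<Sum>j<m. norm (v $v j))"
proof -
  have "norm ((A *\<^sub>v v) $v i) = norm (\<Sum>j<m. A $$ (i, j) * v $v j)"
    using assms(2-4) by (simp add: scalar_prod_def atLeast0LessThan)
  also have "\<dots> \<le> (\<Sum>j<m. b * norm (v $v j))"
    using assms by (auto intro!: sum_norm_le mult_right_mono simp: norm_mult norm_bound_def)
  finally show ?thesis
    by (simp add: sum_distrib_left)
qed

(* Bounds on matrix powers via the Jordan normal form exist only for Jordan_Normal_Form
   matrices, so type-indexed matrices are transported along an enumeration f of the index type. *)
definition mat_of_cart :: "(nat \<Rightarrow> 'n::finite) \<Rightarrow> 'a^'n^'n \<Rightarrow> 'a mat" where
  "mat_of_cart f C = mat CARD('n) CARD('n) (\<lambda>(i, j). C $ f i $ f j)"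

definition vec_of_cart :: "(nat \<Rightarrow> 'n::finite) \<Rightarrow> 'a^'n \<Rightarrow> 'a Matrix.vec" where
  "vec_of_cart f v = Matrix.vec CARD('n) (\<lambda>i. v $ f i)"

lemma mat_of_cart_carrier [simp]:
  "mat_of_cart f (C :: 'a^'n::finite^'n) \<in> carrier_mat CARD('n) CARD('n)"
  by (simp add: mat_of_cart_def)

lemma vec_of_cart_carrier [simp]: "vec_of_cart f (v :: 'a^'n::finite) \<in> carrier_vec CARD('n)"
  by (simp add: vec_of_cart_def)

context
  fixes f :: "nat \<Rightarrow> 'n::finite"
  assumes f: "bij_betw f {0..<CARD('n)} UNIV"
begin

lemma vec_of_cart_mult:
  fixes C :: "'a::semiring_1^'n^'n"
  shows "vec_of_cart f (C *v v) = mat_of_cart f C *\<^sub>v vec_of_cart f v"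
proof (rule eq_vecI)
  fix i
  assume "i < dim_vec (mat_of_cart f C *\<^sub>v vec_of_cart f v)"
  then have i: "i < CARD('n)"
    by (simp add: mat_of_cart_def)
  have "(mat_of_cart f C *\<^sub>v vec_of_cart f v) $v i = (\<Sum>j = 0..<CARD('n). C $ f i $ f j * v $ f j)"
    using i by (simp add: mat_of_cart_def vec_of_cart_def scalar_prod_def)
  also have "\<dots> = (\<Sum>d\<in>UNIV. C $ f i $ d * v $ d)"
    by (rule sum.reindex_bij_betw[OF f])
  finally show "vec_of_cart f (C *v v) $v i = (mat_of_cart f C *\<^sub>v vec_of_cart f v) $v i"
    using i by (simp add: vec_of_cart_def matrix_vector_mult_def)
qed (simp add: vec_of_cart_def mat_of_cart_def)

lemma vec_of_cart_funpow_mult: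
  fixes C :: "'a::semiring_1^'n^'n"
  shows "vec_of_cart f (((*v) C ^^ k) v) = mat_of_cart f C ^\<^sub>m k *\<^sub>v vec_of_cart f v"
proof (induction k arbitrary: v)
  case 0
  show ?case
    using vec_of_cart_carrier[of f v] by (simp add: mat_of_cart_def)
next
  case (Suc k)
  have "vec_of_cart f (((*v) C ^^ Suc k) v) =
      mat_of_cart f C ^\<^sub>m k *\<^sub>v (mat_of_cart f C *\<^sub>v vec_of_cart f v)"
    by (simp add: funpow_Suc_right Suc.IH vec_of_cart_mult del: funpow.simps)
  also have "\<dots> = mat_of_cart f C ^\<^sub>m Suc k *\<^sub>v vec_of_cart f v"
    by (simp add: assoc_mult_mat_vec[OF pow_carrier_mat[OF mat_of_cart_carrier] mat_of_cart_carrier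
          vec_of_cart_carrier])
  finally show ?case .
qed

lemma vec_of_cart_inj: "inj (vec_of_cart f)"
proof (rule injI)
  fix a b :: "'a^'n"
  assume eq: "vec_of_cart f a = vec_of_cart f b"
  have "a $ d = b $ d" for d
  proof -
    obtain i where "i < CARD('n)" "d = f i"
      using f unfolding bij_betw_def by force
    with arg_cong[OF eq, of "\<lambda>w. w $v i"] show ?thesis
      by (simp add: vec_of_cart_def)
  qed
  then show "a = b"
    by (simp add: Finite_Cartesian_Product.vec_eq_iff)
qed

lemma vec_of_cart_surj:
  assumes "w \<in> carrier_vec CARD('n)"
  shows "\<exists>v. vec_of_cart f v = w"
proof
  show "vec_of_cart f (\<chi> d. w $v inv_into {0..<CARD('n)} f d) = w"
    using assms f by (intro eq_vecI) (auto simp: vec_of_cart_def bij_betw_inv_into_left)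
qed

lemma eigenvector_if_eigenvalue_mat_of_cart:
  fixes C :: "'a::field^'n^'n"
  assumes "eigenvalue (mat_of_cart f C) c"
  shows "\<exists>v. v \<noteq> 0 \<and> C *v v = c *s v"
proof -
  obtain w where w: "w \<in> carrier_vec CARD('n)" "w \<noteq> 0\<^sub>v CARD('n)"
    "mat_of_cart f C *\<^sub>v w = c \<cdot>\<^sub>v w"
    using assms mat_of_cart_carrier[of f C] unfolding eigenvalue_def eigenvector_def by auto
  obtain v where v: "vec_of_cart f v = w"
    using vec_of_cart_surj[OF w(1)] by blast
  have "vec_of_cart f (C *v v) = c \<cdot>\<^sub>v w"
    using w(3) v by (simp add: vec_of_cart_mult)
  also have "\<dots> = vec_of_cart f (c *s v)"
    using v by (auto simp: vec_of_cart_def)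
  finally have "vec_of_cart f (C *v v) = vec_of_cart f (c *s v)" .
  then have "C *v v = c *s v"
    by (rule injD[OF vec_of_cart_inj])
  moreover have "v \<noteq> 0"
    using v w(2) by (auto simp: vec_of_cart_def)
  ultimately show ?thesis
    by blast
qed

end

lemma funpow_mult_bound_if_eigenvalues_less:
  fixes C :: "complex^'n::finite^'n"
  assumes ev: "\<And>c v. v \<noteq> 0 \<Longrightarrow> C *v v = c *s v \<Longrightarrow> cmod c < \<rho>"
  shows "\<exists>K r. 0 < r \<and> r < \<rho> \<and> (\<forall>k i. cmod ((((*v) C ^^ k) w) $ i) \<le> K * r ^ k)"
proof -
  obtain f :: "nat \<Rightarrow> 'n" where f: "bij_betw f {0..<CARD('n)} UNIV"
    using ex_bij_betw_nat_finite[of "UNIV :: 'n set"] by auto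
  have "cmod c < \<rho>" if "eigenvalue (mat_of_cart f C) c" for c
    using eigenvector_if_eigenvalue_mat_of_cart[OF f that] ev by blast
  then obtain b r where r: "0 < r" "r < \<rho>"
    and b: "\<And>k. norm_bound (mat_of_cart f C ^\<^sub>m k) (b * r ^ k)"
    using pow_norm_bound_if_eigenvalues_less[OF mat_of_cart_carrier zero_less_card_finite] by blast
  define K where "K = b * (\<Sum>j<CARD('n). cmod (vec_of_cart f w $v j))"
  have "cmod ((((*v) C ^^ k) w) $ i) \<le> K * r ^ k" for k i
  proof -
    obtain j where j: "j < CARD('n)" "i = f j"
      using f unfolding bij_betw_def by force
    then have "(((*v) C ^^ k) w) $ i = vec_of_cart f (((*v) C ^^ k) w) $v j"
      by (simp add: vec_of_cart_def)
    also have "\<dots> = (mat_of_cart f C ^\<^sub>m k *\<^sub>v vec_of_cart f w) $v j"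
      by (simp only: vec_of_cart_funpow_mult[OF f])
    also have "cmod \<dots> \<le> b * r ^ k * (\<Sum>j<CARD('n). cmod (vec_of_cart f w $v j))"
      using j(1) by (intro norm_mult_mat_vec_index_le[OF b]) auto
    finally show ?thesis
      by (simp add: K_def ac_simps)
  qed
  with r show ?thesis
    by blast
qed

lemma cmat_funpow_mult:
  fixes C :: "real^'n::finite^'n"
  shows "((*v) (cmat C) ^^ k) (\<chi> i. complex_of_real (x $ i)) =
    (\<chi> i. complex_of_real ((((*v) C ^^ k) x) $ i))"
  by (induction k) (simp_all add: Finite_Cartesian_Product.vec_eq_iff matrix_vector_mult_def cmat_def)

lemma rho_schur_funpow_decay:
  assumes "rho_schur \<rho> C"
  shows "(\<lambda>k. inverse (\<rho> ^ k) *\<^sub>R ((*v) C ^^ k) x) \<longlonglongrightarrow> 0"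
proof -
  obtain K r where r: "0 < r" "r < \<rho>"
    and K: "\<And>k i. cmod ((((*v) (cmat C) ^^ k) (\<chi> i. complex_of_real (x $ i))) $ i) \<le> K * r ^ k"
    using funpow_mult_bound_if_eigenvalues_less[of "cmat C" \<rho>] assms unfolding rho_schur_def by blast
  show ?thesis
  proof (rule vec_tendstoI)
    fix i
    have le: "norm (inverse (\<rho> ^ k) * (((*v) C ^^ k) x) $ i) \<le> K * (r / \<rho>) ^ k" for k
    proof -
      have "\<bar>(((*v) C ^^ k) x) $ i\<bar> \<le> K * r ^ k"
        using K[of k i] by (simp add: cmat_funpow_mult)
      with r show ?thesis
        by (simp add: abs_mult power_divide divide_right_mono field_simps)
    qed
    have lim: "(\<lambda>k. K * (r / \<rho>) ^ k) \<longlonglongrightarrow> 0"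
      using r by (intro tendsto_mult_right_zero LIMSEQ_power_zero) auto
    have "(\<lambda>k. inverse (\<rho> ^ k) * (((*v) C ^^ k) x) $ i) \<longlonglongrightarrow> 0"
      by (intro Lim_null_comparison[OF _ lim] always_eventually allI le)
    then show "(\<lambda>k. (inverse (\<rho> ^ k) *\<^sub>R ((*v) C ^^ k) x) $ i) \<longlonglongrightarrow> 0 $ i"
      by simp
  qed
qed

lemma quadratic_form_feedback:
  fixes Q :: "real^'d^'d" and S :: "real^'d^'q" and R :: "real^'q^'q" and K :: "real^'d^'q"
  shows "x \<bullet> ((Q + (transpose S ** K + transpose K ** S) + transpose K ** R ** K) *v x) =
    (Q *v x) \<bullet> x + 2 * ((S *v x) \<bullet> (K *v x)) + (R *v (K *v x)) \<bullet> (K *v x)"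
proof -
  have vmul: "u \<bullet> (y v* M) = (M *v u) \<bullet> y" for u :: "real^'d" and y :: "real^'q" and M
    by (metis dot_lmul_matrix inner_commute)
  show ?thesis
    by (simp add: matrix_vector_mult_add_rdistrib inner_add_right vmul inner_commute
        flip: matrix_vector_mul_assoc)
qed

lemma min_stable_if_stabilizing_feedback:
  fixes K :: "real^'d^'q"
  assumes schur: "rho_schur \<rho> (A + B ** K)"
    and psd: "psd (Q + (transpose S ** K + transpose K ** S) + transpose K ** R ** K)"
  shows "min_stable \<rho> A B Q S R"
  unfolding min_stable_def
proof
  fix x0 :: "real^'d"
  define x where "x k = ((*v) (A + B ** K) ^^ k) x0" for k
  define w where "w k = K *v x k" for k
  have "behav A B x w"
    by (simp add: behav_def x_def w_def matrix_vector_mult_add_rdistrib matrix_vector_mul_assoc)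
  moreover have "IQC Q S R \<rho> x w"
    using psd unfolding IQC_def w_def
    by (auto simp: psd_def power_mult quadratic_form_feedback[symmetric]
        intro!: sum_nonneg mult_nonneg_nonneg)
  moreover have "(\<lambda>k. inverse (\<rho> ^ k) *\<^sub>R x k) \<longlonglongrightarrow> 0"
    unfolding x_def by (rule rho_schur_funpow_decay[OF schur])
  moreover have "x 0 = x0"
    by (simp add: x_def)
  ultimately show "\<exists>x w. behav A B x w \<and> IQC Q S R \<rho> x w \<and> x 0 = x0 \<and>
      (\<lambda>k. inverse (\<rho> ^ k) *\<^sub>R x k) \<longlonglongrightarrow> 0"
    by blast
qed

definition inl_vec :: "'a::zero^'n::finite \<Rightarrow> 'a^('n + 'm::finite)" where
  "inl_vec u = (\<chi> j. case j of Inl a \<Rightarrow> u $ a | Inr _ \<Rightarrow> 0)"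

lemma sum_UNIV_Plus:
  "sum g (UNIV :: ('a::finite + 'b::finite) set) = (\<Sum>a\<in>UNIV. g (Inl a)) + (\<Sum>b\<in>UNIV. g (Inr b))"
  using sum.Plus[of "UNIV :: 'a set" "UNIV :: 'b set" g] by (simp add: comp_def)

lemma inl_vec_mult: "inl_vec N *v x = inl_vec (N *v x)"
  by (simp add: inl_vec_def matrix_vector_mult_def Finite_Cartesian_Product.vec_eq_iff split: sum.split)

lemma inner_inl_vec: "inl_vec u \<bullet> inl_vec v = u \<bullet> v"
  by (simp add: inner_vec_def inl_vec_def sum_UNIV_Plus)

lemma S2_eq_inl_vec: "S2 S = inl_vec S"
  by (simp add: S2_def inl_vec_def Finite_Cartesian_Product.vec_eq_iff split: sum.split)

lemma B2_mult_inl_vec: "B2 B *v inl_vec u = B *v u"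
  by (simp add: B2_def inl_vec_def matrix_vector_mult_def sum_UNIV_Plus
      Finite_Cartesian_Product.vec_eq_iff)

lemma R2_mult_inl_vec: "R2 R \<delta> lam *v inl_vec u = inl_vec (R *v u + (lam * \<delta>\<^sup>2) *\<^sub>R u)"
proof -
  have "(\<Sum>b\<in>UNIV. (R $ a $ b + lam * \<delta>\<^sup>2 * (if a = b then 1 else 0)) * u $ b) =
      (R *v u) $ a + lam * \<delta>\<^sup>2 * u $ a" for a
    by (simp add: matrix_vector_mult_def distrib_right sum.distrib mult.assoc of_bool_def[symmetric]
        flip: sum_distrib_left)
  then show ?thesis
    by (simp add: R2_def inl_vec_def matrix_vector_mult_def sum_UNIV_Plus
        Finite_Cartesian_Product.vec_eq_iff split: sum.split)
qed

lemma matrix_mult_B2_inl_vec: "B2 B ** inl_vec N = B ** N"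
  by (simp add: matrix_eq inl_vec_mult B2_mult_inl_vec flip: matrix_vector_mul_assoc)

lemma quadratic_form_feedback_inl_vec:
  "x \<bullet> ((Q + (transpose (S2 S) ** inl_vec N + transpose (inl_vec N) ** S2 S) +
      transpose (inl_vec N) ** R2 R \<delta> lam ** inl_vec N) *v x) =
    x \<bullet> ((Q + (transpose S ** N + transpose N ** S) + transpose N ** R ** N) *v x) +
      lam * \<delta>\<^sup>2 * ((N *v x) \<bullet> (N *v x))"
  by (simp add: quadratic_form_feedback S2_eq_inl_vec inl_vec_mult R2_mult_inl_vec inner_inl_vec
      inner_add_left)

theorem lemma2p13:
  fixes A :: "real^'d^'d" and B :: "real^'n^'d" and Q :: "real^'d^'d"
    and S :: "real^'d^'n" and R :: "real^'n^'n" and \<rho> \<delta> :: real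
  assumes "transpose Q = Q" and "transpose R = R"
    and "\<rho> > 0" and "\<delta> \<ge> 0"
    and "\<exists>N :: real^'d^'n. rho_schur \<rho> (A + B ** N) \<and>
           psd (Q + (transpose S ** N + transpose N ** S) + transpose N ** R ** N)"
  shows "\<forall>lam\<ge>0. min_stable \<rho> A (B2 B) Q (S2 S) (R2 R \<delta> lam)"
proof (intro allI impI)
  fix lam :: real
  assume lam: "lam \<ge> 0"
  obtain N :: "real^'d^'n" where schur: "rho_schur \<rho> (A + B ** N)"
    and psd: "psd (Q + (transpose S ** N + transpose N ** S) + transpose N ** R ** N)"
    using assms(5) by blast
  let ?K = "inl_vec N :: real^'d^('n + 'n)"
  have "psd (Q + (transpose (S2 S) ** ?K + transpose ?K ** S2 S) + transpose ?K ** R2 R \<delta> lam ** ?K)"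
    using psd lam unfolding psd_def quadratic_form_feedback_inl_vec
    by (simp add: add_nonneg_nonneg)
  moreover have "rho_schur \<rho> (A + B2 B ** ?K)"
    using schur by (simp add: matrix_mult_B2_inl_vec)
  ultimately show "min_stable \<rho> A (B2 B) Q (S2 S) (R2 R \<delta> lam)"
    by (rule min_stable_if_stabilizing_feedback[rotated])
qed

end
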